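(* For any two rectifiable curves $A,B\in\mathcal C$ with $L(A),L(B)>0$, $$R_{\mathrm{FW}}(A,B)\subseteq\mathcal R(A,B).$$
   Context: Curve space. Let $\mathbb S^1=[0,1]/\{0\sim1\}$ and $I\in\{[0,1],\mathbb S^1\}$. $\mathcal F(I)$ is the set of continuous maps $f:I\to\mathbb R^2$ of finite length $L(f)=\sup\sum_j\|f(\tau_j)-f(\tau_{j-1})\|_2$ (supremum over partitions $0=\tau_0<\dots<\tau_J=1$) whose arc-length map $s_f(t)=L(f|_{[0,t]})$ is strictly increasing (for $I=\mathbb S^1$, $f$ is identified with a continuous map on $[0,1]$ with $f(0)=f(1)$). Write $f_1\sim f_2$ if $f_1=f_2\circ\phi$ for an orientation-preserving or orientation-reversing homeomorphism $\phi:I\to I$. The curve space is $\mathcal C=(\mathcal F([0,1])/\!\sim)\sqcup(\mathcal F(\mathbb S^1)/\!\sim)$; elements of the first part are called open, of the second part closed. For $C\in\mathcal C$, the length $L(C)=L(f)$ and the trace $\Gamma_C=f(I)$ do not depend on the representative $f\in C$. Arc-length representative. An arc-length representative of $C$ is $\beta_C^{\mathrm{arc}}=f\circ s_f^{-1}$ on $[0,L(C)]$ (with $0\sim L(C)$ identified if $C$ is closed), for a representative $f$ of $C$; it is unique up to orientation reversal (open case), or up to circular shift and reversal (closed case). Global band: $\mathcal R(A,B)=\{(1-\lambda)x+\lambda y: x\in\Gamma_A,\ y\in\Gamma_B,\ \lambda\in[0,1]\}$. Fast-walk (FW) band. Put $\beta_C(t)=\beta_C^{\mathrm{arc}}(L(C)t)$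 on $[0,1]$ or $\mathbb S^1$. If $C$ is open, $\mathcal G(C)=\{\beta_C,\beta_C^{\leftarrow}\}$ with $\beta_C^{\leftarrow}(t)=\beta_C(1-t)$. If $C$ is closed, $\mathcal G(C)=\{\beta_C^\theta,(\beta_C^\theta)^{\leftarrow}:\theta\in\mathbb S^1\}$ with $\beta_C^\theta(t)=\beta_C(t+\theta \bmod 1)$ and $(\beta_C^\theta)^{\leftarrow}(t)=\beta_C(\theta-t \bmod 1)$ (so each element has equal values at $0$ and $1$). For $\alpha\in\mathcal G(A)$, $\beta\in\mathcal G(B)$, let $\gamma_{\alpha,\beta}:\mathbb S^1\to\mathbb R^2$ be the closed loop obtained by concatenating $\alpha$ on $[0,1]$, the segment from $\alpha(1)$ to $\beta(1)$, $\beta$ traversed in reverse, and the segment from $\beta(0)$ to $\alpha(0)$ (each on a quarter of $\mathbb S^1$), and let $W(\alpha,\beta)$ be its image. For $p\notin W(\alpha,\beta)$ let $n_2(\gamma_{\alpha,\beta};p)\in\{0,1\}$ be the degree of $t\mapsto(\gamma_{\alpha,\beta}(t)-p)/\|\gamma_{\alpha,\beta}(t)-p\|$ reduced mod $2$. Set $E(\alpha,\beta)=W(\alpha,\beta)\cup\{p\notin W(\alpha,\beta): n_2(\gamma_{\alpha,\beta};p)=1\}$ and $\Delta(\alpha,\beta)=\|\alpha(1)-\beta(1)\|_2+\|\alpha(0)-\beta(0)\|_2$; let $\mathcal M(A,B)$ be the set of minimizers of $\Delta$ over $\mathcal G(A)\times\mathcal G(B)$. The FW band is $R_{\mathrm{FW}}(A,B)=\mathrm{cl}\bigl(\bigcup_{(\alpha,\beta)\in\mathcal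 M(A,B)}E(\alpha,\beta)\bigr)$. *)

theory Defs
  imports "HOL-Complex_Analysis.Complex_Analysis"
begin

type_synonym plane = "real ^ 2"


subsection \<open>Curves\<close>

definition polygonal_sums :: "(real \<Rightarrow> plane) \<Rightarrow> real \<Rightarrow> real \<Rightarrow> real set" where
  "polygonal_sums f a b =
     {(\<Sum>j<J. norm (f (\<tau> (Suc j)) - f (\<tau> j))) | (\<tau> :: nat \<Rightarrow> real) (J :: nat).
        \<tau> 0 = a \<and> \<tau> J = b \<and> (\<forall>j<J. \<tau> j < \<tau> (Suc j))}"

definition finite_length :: "(real \<Rightarrow> plane) \<Rightarrow> real \<Rightarrow> real \<Rightarrow> bool" where
  "finite_length f a b \<longleftrightarrow> bdd_above (polygonal_sums f a b)"

text \<open>A real supremum, hence meaningful only under \<^const>\<open>finite_length\<close>.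
  For \<open>a = b\<close> the one-point partition (\<open>J = 0\<close>) gives length 0.\<close>
definition length_on :: "(real \<Rightarrow> plane) \<Rightarrow> real \<Rightarrow> real \<Rightarrow> real" where
  "length_on f a b = Sup (polygonal_sums f a b)"

definition arclen :: "(real \<Rightarrow> plane) \<Rightarrow> real \<Rightarrow> real" where
  "arclen f t = length_on f 0 t"

text \<open>Only the values of a parametrization on \<open>{0..1}\<close> matter; the equivalence relations below
  identify functions that agree there.\<close>
definition open_params :: "(real \<Rightarrow> plane) set" where
  "open_params = {f. continuous_on {0..1} f \<and> finite_length f 0 1 \<and>
                     strict_mono_on {0..1} (arclen f)}"

definition closed_params :: "(real \<Rightarrow> plane) set" where
  "closed_params = {f \<in> open_params. f 0 = f 1}"

text \<open>Every homeomorphism of \<open>{0..1}\<close> or of the circle preserves or reverses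
  orientation, so no condition on the orientation is needed.\<close>
definition open_rel :: "((real \<Rightarrow> plane) \<times> (real \<Rightarrow> plane)) set" where
  "open_rel = {(f1, f2). f1 \<in> open_params \<and> f2 \<in> open_params \<and>
     (\<exists>\<phi> \<psi>. homeomorphism {0..1} {0..1} \<phi> \<psi> \<and> (\<forall>t\<in>{0..1}. f1 t = f2 (\<phi> t)))}"

text \<open>The circle \<open>[0,1]/{0 \<sim> 1}\<close> is realized as the unit circle in the complex
  plane via \<open>t \<mapsto> cis (2 * pi * t)\<close>.\<close>
definition circle_pt :: "real \<Rightarrow> complex" where
  "circle_pt t = cis (2 * pi * t)"

definition closed_rel :: "((real \<Rightarrow> plane) \<times> (real \<Rightarrow> plane)) set" where
  "closed_rel = {(f1, f2). f1 \<in> closed_params \<and> f2 \<in> closed_params \<and>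
     (\<exists>\<phi> \<psi>. homeomorphism (sphere 0 1) (sphere 0 1) \<phi> \<psi> \<and>
        (\<forall>t\<in>{0..1}. \<forall>u\<in>{0..1}. \<phi> (circle_pt t) = circle_pt u \<longrightarrow> f1 t = f2 u))}"

text \<open>\<^const>\<open>Inl\<close> tags the open curves, \<^const>\<open>Inr\<close> the closed ones.\<close>
type_synonym curve = "(real \<Rightarrow> plane) set + (real \<Rightarrow> plane) set"

definition curve_space :: "curve set" where
  "curve_space = (open_params // open_rel) <+> (closed_params // closed_rel)"

definition curve_rep :: "curve \<Rightarrow> real \<Rightarrow> plane" where
  "curve_rep C = (case C of Inl X \<Rightarrow> (SOME f. f \<in> X) | Inr X \<Rightarrow> (SOME f. f \<in> X))"

definition curve_length :: "curve \<Rightarrow> real" where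
  "curve_length C = length_on (curve_rep C) 0 1"

definition curve_trace :: "curve \<Rightarrow> plane set" where
  "curve_trace C = curve_rep C ` {0..1}"

definition arc_rep :: "curve \<Rightarrow> real \<Rightarrow> plane" where
  "arc_rep C = curve_rep C \<circ> the_inv_into {0..1} (arclen (curve_rep C))"


subsection \<open>Global band\<close>

definition global_band :: "curve \<Rightarrow> curve \<Rightarrow> plane set" where
  "global_band A B =
     {(1 - l) *\<^sub>R x + l *\<^sub>R y | l x y.
        x \<in> curve_trace A \<and> y \<in> curve_trace B \<and> l \<in> {0..1}}"


subsection \<open>Fast-walk band\<close>

definition const_speed :: "curve \<Rightarrow> real \<Rightarrow> plane" where
  "const_speed C t = arc_rep C (curve_length C * t)"

definition fw_params :: "curve \<Rightarrow> (real \<Rightarrow> plane) set" where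
  "fw_params C = (case C of
       Inl _ \<Rightarrow> {const_speed C, \<lambda>t. const_speed C (1 - t)}
     | Inr _ \<Rightarrow> (\<Union>\<theta>\<in>{0..<1}. {\<lambda>t. const_speed C (frac (t + \<theta>)),
                                \<lambda>t. const_speed C (frac (\<theta> - t))}))"

definition fw_loop :: "(real \<Rightarrow> plane) \<Rightarrow> (real \<Rightarrow> plane) \<Rightarrow> real \<Rightarrow> plane" where
  "fw_loop \<alpha> \<beta> = (\<alpha> +++ linepath (\<alpha> 1) (\<beta> 1)) +++ (reversepath \<beta> +++ linepath (\<beta> 0) (\<alpha> 0))"

text \<open>Degree of a continuous self-map of the circle, given as a loop \<open>u\<close> of unit
  vectors on \<open>{0..1}\<close>: the total change, in full turns, of a continuous angle along \<open>u\<close>.\<close>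
definition circle_degree :: "(real \<Rightarrow> plane) \<Rightarrow> int" where
  "circle_degree u = (THE k. \<exists>\<theta>. continuous_on {0..1} \<theta> \<and>
     (\<forall>t\<in>{0..1}. u t = vector [cos (\<theta> t), sin (\<theta> t)]) \<and>
     \<theta> 1 - \<theta> 0 = 2 * pi * of_int k)"

definition mod2_degree :: "(real \<Rightarrow> plane) \<Rightarrow> plane \<Rightarrow> int" where
  "mod2_degree \<gamma> p = circle_degree (\<lambda>t. (\<gamma> t - p) /\<^sub>R norm (\<gamma> t - p)) mod 2"

definition fw_region :: "(real \<Rightarrow> plane) \<Rightarrow> (real \<Rightarrow> plane) \<Rightarrow> plane set" where
  "fw_region \<alpha> \<beta> = path_image (fw_loop \<alpha> \<beta>) \<union>
     {p. p \<notin> path_image (fw_loop \<alpha> \<beta>) \<and> mod2_degree (fw_loop \<alpha> \<beta>) p = 1}"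

definition endpoint_cost :: "(real \<Rightarrow> plane) \<Rightarrow> (real \<Rightarrow> plane) \<Rightarrow> real" where
  "endpoint_cost \<alpha> \<beta> = norm (\<alpha> 1 - \<beta> 1) + norm (\<alpha> 0 - \<beta> 0)"

definition fw_minimizers :: "curve \<Rightarrow> curve \<Rightarrow> ((real \<Rightarrow> plane) \<times> (real \<Rightarrow> plane)) set" where
  "fw_minimizers A B =
     {q. is_arg_min (\<lambda>(\<alpha>, \<beta>). endpoint_cost \<alpha> \<beta>) (\<lambda>q. q \<in> fw_params A \<times> fw_params B) q}"

definition fw_band :: "curve \<Rightarrow> curve \<Rightarrow> plane set" where
  "fw_band A B = closure (\<Union>(\<alpha>, \<beta>)\<in>fw_minimizers A B. fw_region \<alpha> \<beta>)"


subsection \<open>Well-definedness\<close>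

lemma equiv_open_rel: "equiv open_params open_rel"
proof (rule equivI)
  show "open_rel \<subseteq> open_params \<times> open_params" by (auto simp: open_rel_def)
  show "refl_on open_params open_rel"
    unfolding refl_on_def open_rel_def
    by (auto intro!: exI[of _ "\<lambda>x. x"] simp: homeomorphism_ident)
  show "sym open_rel"
  proof (rule symI)
    fix f g assume "(f, g) \<in> open_rel"
    then obtain \<phi> \<psi> where *: "f \<in> open_params" "g \<in> open_params"
      "homeomorphism {0..1} {0..1} \<phi> \<psi>" "\<forall>t\<in>{0..1}. f t = g (\<phi> t)"
      by (auto simp: open_rel_def)
    have "\<forall>t\<in>{0..1}. g t = f (\<psi> t)"
      using *(3,4) unfolding homeomorphism_def by (metis image_eqI)
    then show "(g, f) \<in> open_rel"
      using * homeomorphism_sym unfolding open_rel_def by blast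
  qed
  show "trans open_rel"
  proof (rule transI)
    fix f g h assume "(f, g) \<in> open_rel" "(g, h) \<in> open_rel"
    then obtain \<phi> \<psi> \<phi>' \<psi>' where *: "f \<in> open_params" "h \<in> open_params"
      "homeomorphism {0..1::real} {0..1::real} \<phi> \<psi>" "\<forall>t\<in>{0..1}. f t = g (\<phi> t)"
      "homeomorphism {0..1::real} {0..1::real} \<phi>' \<psi>'" "\<forall>t\<in>{0..1}. g t = h (\<phi>' t)"
      by (auto simp: open_rel_def)
    have "\<forall>t\<in>{0..1}. f t = h ((\<phi>' \<circ> \<phi>) t)"
      using *(3,4,6) unfolding homeomorphism_def by (metis comp_apply image_eqI)
    then show "(f, h) \<in> open_rel"
      using *(1,2) homeomorphism_compose[OF *(3,5)] unfolding open_rel_def by blast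
  qed
qed

lemma circle_pt_image: "circle_pt ` {0..1} = sphere 0 1"
proof
  show "circle_pt ` {0..1} \<subseteq> sphere 0 1" by (auto simp: circle_pt_def)
  show "sphere 0 1 \<subseteq> circle_pt ` {0..1}"
  proof
    fix z :: complex assume "z \<in> sphere 0 1"
    then have z: "z = cis (Arg2pi z)"
      using Arg2pi_eq[of z] by (simp add: cis_conv_exp)
    have "Arg2pi z / (2 * pi) \<in> {0..1}"
      using Arg2pi_ge_0[of z] Arg2pi_lt_2pi[of z] by (simp add: field_simps)
    moreover have "z = circle_pt (Arg2pi z / (2 * pi))"
      using z by (simp add: circle_pt_def)
    ultimately show "z \<in> circle_pt ` {0..1}" by blast
  qed
qed

lemma circle_pt_eq:
  assumes "circle_pt s = circle_pt t" "s \<in> {0..1}" "t \<in> {0..1}"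
  shows "s = t \<or> {s, t} = {0, 1}"
proof -
  obtain n :: int where n: "2 * pi * s = 2 * pi * t + 2 * pi * n"
    using assms(1) unfolding circle_pt_def cis_conv_exp exp_eq
    by (auto simp: complex_eq_iff algebra_simps)
  then have "2 * pi * s = 2 * pi * (t + n)" by (simp add: algebra_simps)
  then have st: "s = t + n" by simp
  then have "n = 0 \<or> n = 1 \<or> n = -1" using assms(2,3) by auto
  then show ?thesis using st assms(2,3) by auto
qed

lemma equiv_closed_rel: "equiv closed_params closed_rel"
proof (rule equivI)
  show "closed_rel \<subseteq> closed_params \<times> closed_params" by (auto simp: closed_rel_def)
  have "(f, f) \<in> closed_rel" if f: "f \<in> closed_params" for f
  proof -
    have "f t = f u" if "circle_pt t = circle_pt u" "t \<in> {0..1}" "u \<in> {0..1}" for t u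
      using circle_pt_eq[OF that] f by (auto simp: closed_params_def doubleton_eq_iff)
    then show ?thesis
      using f homeomorphism_ident[of "sphere (0::complex) 1"] unfolding closed_rel_def by blast
  qed
  then show "refl_on closed_params closed_rel" by (auto simp: refl_on_def)
  show "sym closed_rel"
  proof (rule symI)
    fix f g assume "(f, g) \<in> closed_rel"
    then obtain \<phi> \<psi> where *: "f \<in> closed_params" "g \<in> closed_params"
      "homeomorphism (sphere 0 1) (sphere 0 1) \<phi> \<psi>"
      "\<forall>t\<in>{0..1}. \<forall>u\<in>{0..1}. \<phi> (circle_pt t) = circle_pt u \<longrightarrow> f t = g u"
      by (auto simp: closed_rel_def)
    have "g t = f u" if "t \<in> {0..1}" "u \<in> {0..1}" "\<psi> (circle_pt t) = circle_pt u" for t u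
    proof -
      have "circle_pt t \<in> sphere 0 1" using that circle_pt_image by blast
      then have "\<phi> (circle_pt u) = circle_pt t"
        using *(3) that(3) unfolding homeomorphism_def by metis
      then show ?thesis using *(4) that by metis
    qed
    then show "(g, f) \<in> closed_rel"
      using *(1,2) homeomorphism_symD[OF *(3)] unfolding closed_rel_def by blast
  qed
  show "trans closed_rel"
  proof (rule transI)
    fix f g h assume "(f, g) \<in> closed_rel" "(g, h) \<in> closed_rel"
    then obtain \<phi> \<psi> \<phi>' \<psi>' where *: "f \<in> closed_params" "h \<in> closed_params"
      "homeomorphism (sphere (0::complex) 1) (sphere (0::complex) 1) \<phi> \<psi>"
      "\<forall>t\<in>{0..1}. \<forall>u\<in>{0..1}. \<phi> (circle_pt t) = circle_pt u \<longrightarrow> f t = g u"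
      "homeomorphism (sphere (0::complex) 1) (sphere (0::complex) 1) \<phi>' \<psi>'"
      "\<forall>t\<in>{0..1}. \<forall>u\<in>{0..1}. \<phi>' (circle_pt t) = circle_pt u \<longrightarrow> g t = h u"
      by (auto simp: closed_rel_def)
    have "f t = h u" if "t \<in> {0..1}" "u \<in> {0..1}" "(\<phi>' \<circ> \<phi>) (circle_pt t) = circle_pt u" for t u
    proof -
      have "\<phi> (circle_pt t) \<in> sphere 0 1"
        using *(3) that circle_pt_image unfolding homeomorphism_def by blast
      then obtain r where r: "r \<in> {0..1}" "\<phi> (circle_pt t) = circle_pt r"
        using circle_pt_image by (metis imageE)
      have "f t = g r" using *(4) r that(1) by blast
      moreover have "g r = h u" using *(6) r that by simp
      ultimately show ?thesis by simp
    qed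
    then show "(f, h) \<in> closed_rel"
      using *(1,2) homeomorphism_compose[OF *(3,5)] unfolding closed_rel_def by blast
  qed
qed

lemma circle_degree_winding_number:
  assumes u: "continuous_on {0..1} u" "u 0 = u 1" "\<And>t. t \<in> {0..1} \<Longrightarrow> norm (u t) = 1"
  shows "of_int (circle_degree u) = winding_number (\<lambda>t. Complex (u t $ 1) (u t $ 2)) 0"
proof -
  define c where "c = (\<lambda>t. Complex (u t $ 1) (u t $ 2))"
  define P where "P = (\<lambda>k::int. \<exists>\<theta>. continuous_on {0..1} \<theta> \<and>
     (\<forall>t\<in>{0..1}. u t = vector [cos (\<theta> t), sin (\<theta> t)]) \<and> \<theta> 1 - \<theta> 0 = 2 * pi * of_int k)"
  have ueq: "u t = vector [cos x, sin x] \<longleftrightarrow> c t = cis x" for t x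
    by (auto simp: c_def vec_eq_iff forall_2 complex_eq_iff)
  have nc: "norm (c t) = 1" if "t \<in> {0..1}" for t
    using u(3)[OF that] by (simp add: c_def norm_vec_def L2_set_def sum_2 cmod_def)
  have pc: "path c"
    unfolding path_def c_def Complex_eq using u(1) by (intro continuous_intros)
  have 0: "0 \<notin> path_image c"
  proof
    assume "0 \<in> path_image c"
    then obtain t where "t \<in> {0..1}" "c t = 0" unfolding path_image_def by force
    then show False using nc[of t] by simp
  qed
  have uniq: "of_int k = winding_number c 0" if Pk: "P k" for k
  proof -
    obtain \<theta> where \<theta>: "continuous_on {0..1} \<theta>"
      "\<And>t. t \<in> {0..1} \<Longrightarrow> c t = cis (\<theta> t)" "\<theta> 1 - \<theta> 0 = 2 * pi * of_int k"
      using Pk unfolding P_def ueq by blast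
    let ?q = "\<lambda>t. \<i> * of_real (\<theta> t) :: complex"
    have pq: "path ?q" unfolding path_def using \<theta>(1) by (intro continuous_intros)
    have "winding_number c 0 = winding_number (exp \<circ> ?q) 0"
    proof (rule winding_number_cong)
      fix t :: real assume "0 \<le> t" "t \<le> 1"
      then show "c t = (exp \<circ> ?q) t" using \<theta>(2)[of t] by (simp add: cis_conv_exp)
    qed
    also have "\<dots> = (?q 1 - ?q 0) / (2 * of_real pi * \<i>)"
      using winding_number_compose_exp[OF pq] by (simp add: pathfinish_def pathstart_def)
    also have "?q 1 - ?q 0 = \<i> * of_real (2 * pi * of_int k)"
      using \<theta>(3) by (metis of_real_diff right_diff_distrib)
    also have "\<dots> / (2 * of_real pi * \<i>) = of_int k" by simp
    finally show ?thesis by simp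
  qed
  have "\<exists>k. P k"
  proof -
    obtain q where q: "path q"
      "pathfinish q - pathstart q = 2 * of_real pi * \<i> * winding_number c 0"
      "\<And>t. t \<in> {0..1} \<Longrightarrow> c t = 0 + exp (q t)"
      using winding_number_as_continuous_log[OF pc 0] by metis
    have "winding_number c 0 \<in> \<int>"
      using pc 0 u(2) by (intro integer_winding_number) (auto simp: pathfinish_def pathstart_def c_def)
    then obtain k where k: "winding_number c 0 = of_int k" by (auto elim: Ints_cases)
    have Re0: "Re (q t) = 0" if "t \<in> {0..1}" for t
      using nc[OF that] q(3)[OF that] by simp
    have "continuous_on {0..1} (\<lambda>t. Im (q t))"
      using q(1) unfolding path_def by (intro continuous_intros)
    moreover have "c t = cis (Im (q t))" if "t \<in> {0..1}" for t
      using q(3)[OF that] Re0[OF that] by (simp add: exp_eq_polar)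
    moreover have "Im (q 1) - Im (q 0) = 2 * pi * of_int k"
      using arg_cong[OF q(2), of Im] k by (simp add: pathfinish_def pathstart_def)
    ultimately have "P k" unfolding P_def ueq by (intro exI[of _ "\<lambda>t. Im (q t)"]) auto
    then show ?thesis by blast
  qed
  then obtain k where k: "P k" by blast
  have "circle_degree u = (THE k. P k)"
    unfolding circle_degree_def P_def by simp
  also have "\<dots> = k"
  proof (rule the_equality[where P = P])
    show "P k" by (fact k)
  next
    fix k' assume "P k'"
    then have "(of_int k' :: complex) = of_int k" using uniq k by simp
    then show "k' = k" by simp
  qed
  finally have "circle_degree u = k" .
  then show ?thesis using uniq[OF k] unfolding c_def by simp
qed

end

theory Submission
  imports Defs
begin

text \<open>The straight-line interpolation \<open>(s, t) \<mapsto> (1 - s) \<alpha>(t) + s \<beta>(t)\<close> maps the unit square into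
  the global band, and its restriction to the boundary of the square is the loop of the fast-walk
  band. A point outside the global band is avoided by the whole square, which is contractible, so
  the loop has degree 0 about it. Finally, the global band is compact, hence closed.

  Constant-speed parametrizations are continuous because the arc length attains every intermediate
  value: it is the least function whose increments dominate the chords of the curve, and a jump
  could be removed by continuity of the curve.\<close>

subsection \<open>Arc length\<close>

lemma zero_in_polygonal_sums: "0 \<in> polygonal_sums f a a"
  unfolding polygonal_sums_def by (intro CollectI exI[of _ "\<lambda>_. a"] exI[of _ 0]) auto

lemma polygonal_sums_extend:
  assumes "S \<in> polygonal_sums f a x" "x < y"
  shows "S + norm (f y - f x) \<in> polygonal_sums f a y"
proof -
  obtain \<tau> J where \<tau>: "S = (\<Sum>j<J. norm (f (\<tau> (Suc j)) - f (\<tau> j)))"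
    "\<tau> 0 = a" "\<tau> J = x" "\<forall>j<J. \<tau> j < \<tau> (Suc j)"
    using assms(1) unfolding polygonal_sums_def by blast
  define \<sigma> where "\<sigma> = \<tau>(Suc J := y)"
  have "S + norm (f y - f x) = (\<Sum>j<Suc J. norm (f (\<sigma> (Suc j)) - f (\<sigma> j)))"
    using \<tau> by (simp add: \<sigma>_def)
  moreover have "\<sigma> 0 = a" "\<sigma> (Suc J) = y" "\<forall>j<Suc J. \<sigma> j < \<sigma> (Suc j)"
    using \<tau> assms(2) by (auto simp: \<sigma>_def less_Suc_eq)
  ultimately show ?thesis
    unfolding polygonal_sums_def by blast
qed

lemma polygonal_sums_nonempty: "a \<le> b \<Longrightarrow> polygonal_sums f a b \<noteq> {}"
  using zero_in_polygonal_sums[of f a] polygonal_sums_extend[of 0 f a a b]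
  by (cases "a = b") auto

text \<open>The increments of \<open>v\<close> telescope along the partition. Passing to the
  supremum, any \<open>v\<close> whose increments dominate all chords has total increment at least
  the length; \<open>arclen_no_gap\<close> is refuted through such a \<open>v\<close>.\<close>

lemma polygonal_sum_le_dominating:
  assumes "S \<in> polygonal_sums f a b"
    and dom: "\<And>x y. a \<le> x \<Longrightarrow> x < y \<Longrightarrow> y \<le> b \<Longrightarrow> norm (f y - f x) \<le> v y - v x"
  shows "S \<le> v b - v a"
proof -
  obtain \<tau> J where \<tau>: "S = (\<Sum>j<J. norm (f (\<tau> (Suc j)) - f (\<tau> j)))"
    "\<tau> 0 = a" "\<tau> J = b" "\<And>j. j < J \<Longrightarrow> \<tau> j < \<tau> (Suc j)"
    using assms(1) unfolding polygonal_sums_def by blast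
  \<comment> \<open>Monotonicity keeps all nodes inside \<open>{a..b}\<close>, where
    \<open>dom\<close> applies.\<close>
  have mono: "\<tau> i \<le> \<tau> k" if "i \<le> k" "k \<le> J" for i k
    using that
  proof (induction k rule: dec_induct)
    case (step n)
    then show ?case using \<tau>(4)[of n] by simp
  qed simp
  have "S \<le> (\<Sum>j<J. v (\<tau> (Suc j)) - v (\<tau> j))"
    unfolding \<tau>(1)
  proof (rule sum_mono)
    fix j assume "j \<in> {..<J}"
    then show "norm (f (\<tau> (Suc j)) - f (\<tau> j)) \<le> v (\<tau> (Suc j)) - v (\<tau> j)"
      using mono[of 0 j] mono[of "Suc j" J] \<tau> by (intro dom) auto
  qed
  also have "\<dots> = v b - v a"
    using \<tau>(2,3) sum_lessThan_telescope[of "\<lambda>j. v (\<tau> j)" J] by simp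
  finally show ?thesis .
qed

lemma length_on_le_dominating:
  assumes "a \<le> b"
    and "\<And>x y. a \<le> x \<Longrightarrow> x < y \<Longrightarrow> y \<le> b \<Longrightarrow> norm (f y - f x) \<le> v y - v x"
  shows "length_on f a b \<le> v b - v a"
  unfolding length_on_def
  using polygonal_sums_nonempty[OF assms(1)] polygonal_sum_le_dominating assms(2)
  by (intro cSup_least) blast+

lemma finite_length_initial:
  assumes "finite_length f a b" "x \<le> b"
  shows "finite_length f a x"
proof (cases "x = b")
  case False
  obtain M where M: "\<And>S. S \<in> polygonal_sums f a b \<Longrightarrow> S \<le> M"
    using assms(1) unfolding finite_length_def bdd_above_def by blast
  have "S \<le> M" if "S \<in> polygonal_sums f a x" for S
    using M[OF polygonal_sums_extend[OF that, of b]] False assms(2) norm_ge_zero[of "f b - f x"]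
    by linarith
  then show ?thesis unfolding finite_length_def bdd_above_def by blast
qed (use assms in simp)

text \<open>Appending the chord from \<open>x\<close> to \<open>y\<close> turns a partition up to
  \<open>x\<close> into one up to \<open>y\<close>; then take suprema. Both the monotonicity of the
  arc length and the Lipschitz bound for the arc-length representative come from this
  inequality.\<close>

lemma chord_le_arclen:
  assumes "finite_length f 0 1" "0 \<le> x" "x \<le> y" "y \<le> 1"
  shows "norm (f y - f x) \<le> arclen f y - arclen f x"
proof (cases "x = y")
  case False
  have bdd: "bdd_above (polygonal_sums f 0 y)"
    using finite_length_initial[OF assms(1,4)] by (simp add: finite_length_def)
  have "arclen f x \<le> arclen f y - norm (f y - f x)"
    unfolding arclen_def length_on_def
  proof (rule cSup_least)
    show "polygonal_sums f 0 x \<noteq> {}" using assms(2) by (rule polygonal_sums_nonempty)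
    fix S assume "S \<in> polygonal_sums f 0 x"
    then have "S + norm (f y - f x) \<in> polygonal_sums f 0 y"
      using False assms(3) by (intro polygonal_sums_extend) auto
    from cSup_upper[OF this bdd]
    show "S \<le> Sup (polygonal_sums f 0 y) - norm (f y - f x)" by simp
  qed
  then show ?thesis by simp
qed simp

lemma arclen_mono:
  assumes "finite_length f 0 1" "0 \<le> x" "x \<le> y" "y \<le> 1"
  shows "arclen f x \<le> arclen f y"
  using chord_le_arclen[OF assms] norm_ge_zero[of "f y - f x"] by linarith

lemma arclen_0 [simp]: "arclen f 0 = 0"
proof -
  have "polygonal_sums f 0 0 = {0}"
  proof (intro equalityI subsetI)
    fix S assume S: "S \<in> polygonal_sums f 0 0"
    \<comment> \<open>On a one-point interval the domination condition is vacuous, so the constant 0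
      is admissible.\<close>
    have "S \<le> 0"
      using polygonal_sum_le_dominating[OF S, of "\<lambda>_. 0"] by simp
    moreover have "0 \<le> S"
      using S unfolding polygonal_sums_def by (auto intro: sum_nonneg)
    ultimately show "S \<in> {0}" by simp
  qed (simp add: zero_in_polygonal_sums)
  then show ?thesis by (simp add: arclen_def length_on_def)
qed

section \<open>Intermediate values of the arc length\<close>

text \<open>If the values in \<open>(c, d)\<close> were skipped, the arc length would jump at a
  single parameter \<open>T\<close>. Chords do not see this jump because \<open>f\<close> is
  continuous at \<open>T\<close>, so deleting it leaves a dominating function whose total increment
  is too small by \<open>d - c\<close>.\<close>

lemma arclen_no_gap:
  assumes f: "continuous_on {0..1} f" "finite_length f 0 1"
    and cd: "0 \<le> c" "c < d" "d \<le> arclen f 1"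
  shows "\<exists>x\<in>{0..1}. c < arclen f x \<and> arclen f x < d"
proof (rule ccontr)
  assume "\<not> ?thesis"
  then have gap: "arclen f x \<le> c \<or> d \<le> arclen f x" if "0 \<le> x" "x \<le> 1" for x
    using that by force
  note mono = arclen_mono[OF f(2)]
  define X where "X = {x \<in> {0..1}. arclen f x \<le> c}"
  have X0: "0 \<in> X" using cd(1) by (simp add: X_def)
  have bdd: "bdd_above X" by (rule bdd_aboveI[of _ 1]) (simp add: X_def)
  \<comment> \<open>The jump parameter: \<open>below\<close> and \<open>above\<close> settle the
    values to its left and right, while the value at \<open>T\<close> itself may lie on either side
    of the gap.\<close>
  define T where "T = Sup X"
  have T_ge: "x \<le> T" if "0 \<le> x" "x \<le> 1" "arclen f x \<le> c" for x
    unfolding T_def by (rule cSup_upper[OF _ bdd]) (use that in \<open>simp add: X_def\<close>)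
  have T0: "0 \<le> T" using T_ge[of 0] cd(1) by simp
  have T1: "T \<le> 1"
    unfolding T_def using X0 by (intro cSup_least) (blast, simp add: X_def)
  have below: "arclen f x \<le> c" if "0 \<le> x" "x < T" for x
  proof -
    obtain z where "z \<in> X" "x < z"
      using less_cSupD[of X x] X0 \<open>x < T\<close> unfolding T_def by blast
    then show ?thesis using mono[of x z] that by (simp add: X_def)
  qed
  have above: "d \<le> arclen f x" if "T < x" "x \<le> 1" for x
    using gap[of x] T_ge[of x] that T0 by force
  have across: "norm (f y - f x) \<le> arclen f y - arclen f x - (d - c)"
    if x: "0 \<le> x" "arclen f x \<le> c" and y: "y \<le> 1" "d \<le> arclen f y" and xy: "x < y" for x y
  proof (rule field_le_epsilon)
    fix e :: real assume "0 < e"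
    then obtain \<delta> where "\<delta> > 0"
      and \<delta>: "\<And>r. r \<in> {0..1} \<Longrightarrow> \<bar>r - T\<bar> < \<delta> \<Longrightarrow> norm (f r - f T) < e"
      using f(1) T0 T1 unfolding continuous_on_iff dist_norm by fastforce
    have xT: "x \<le> T" using T_ge[of x] x xy y by simp
    have Ty: "T \<le> y" using below[of y] x xy y cd(2) by force
    \<comment> \<open>Route the chord through \<open>r\<close> and \<open>r'\<close>, which lie on
      opposite sides of the gap with images less than \<open>e\<close> apart. The outer pieces cost
      at most their arc length, and the middle one costs \<open>e\<close> in place of at least
      \<open>d - c\<close>.\<close>
    have bound: "norm (f y - f x) \<le> arclen f y - arclen f x - (d - c) + e"
      if "x \<le> r" "r \<le> r'" "r' \<le> y" "arclen f r \<le> c" "d \<le> arclen f r'" "norm (f r' - f r) < e"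
      for r r'
    proof -
      have "norm (f y - f x) \<le> norm (f y - f r') + norm (f r' - f r) + norm (f r - f x)"
        using norm_triangle_ineq[of "f y - f r'" "f r' - f r"]
          norm_triangle_ineq[of "f y - f r" "f r - f x"] by simp
      moreover have "norm (f y - f r') \<le> arclen f y - arclen f r'"
        using that x y by (intro chord_le_arclen[OF f(2)]) auto
      moreover have "norm (f r - f x) \<le> arclen f r - arclen f x"
        using that x y by (intro chord_le_arclen[OF f(2)]) auto
      ultimately show ?thesis using that by linarith
    qed
    show "norm (f y - f x) \<le> arclen f y - arclen f x - (d - c) + e"
    \<comment> \<open>\<open>T\<close> is the point on its own side of the gap. The other point is
      taken across \<open>T\<close> within distance \<open>\<delta> / 2\<close>; \<open>min\<close>
      and \<open>max\<close> keep it between \<open>x\<close> and \<open>y\<close>.\<close>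
    proof (cases "arclen f T \<le> c")
      case True
      then have "T < y" using Ty y cd(2) by (cases "T = y") auto
      define r where "r = min y (T + \<delta> / 2)"
      have "T < r" "r \<le> y" "\<bar>r - T\<bar> < \<delta>"
        using \<open>T < y\<close> \<open>\<delta> > 0\<close> by (auto simp: r_def min_def field_simps)
      then show ?thesis
        using bound[of T r] \<delta>[of r] above[of r] True xT y T0 by auto
    next
      case False
      then have *: "d \<le> arclen f T" using gap T0 T1 by blast
      then have "x < T" using xT x cd(2) by (cases "T = x") auto
      define r where "r = max x (T - \<delta> / 2)"
      have "r < T" "x \<le> r" "\<bar>r - T\<bar> < \<delta>"
        using \<open>x < T\<close> \<open>\<delta> > 0\<close> by (auto simp: r_def max_def field_simps)
      then show ?thesis
        using bound[of r T] \<delta>[of r] below[of r] * Ty x T1 by (auto simp: norm_minus_commute)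
    qed
  qed
  \<comment> \<open>The arc length with the jump cut out: \<open>v 0 = 0\<close> since
    \<open>0 \<le> c\<close>, and \<open>v 1 = arclen f 1 - (d - c)\<close> since
    \<open>c < d \<le> arclen f 1\<close>.\<close>
  define v where "v = (\<lambda>x. if arclen f x \<le> c then arclen f x else arclen f x - (d - c))"
  have "arclen f 1 \<le> v 1 - v 0"
    unfolding arclen_def[of f 1]
  proof (rule length_on_le_dominating)
    fix x y :: real assume xy: "0 \<le> x" "x < y" "y \<le> 1"
    then show "norm (f y - f x) \<le> v y - v x"
      using chord_le_arclen[OF f(2), of x y] across[of x y] mono[of x y] gap[of y]
      by (auto simp: v_def)
  qed simp
  then show False using cd by (simp add: v_def)
qed

text \<open>\<open>arclen_no_gap\<close> alone gives density of the values. If \<open>u\<close> were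
  missed, a value strictly between \<open>u\<close> and \<open>arclen f t\<close>, at the supremum
  \<open>t\<close> of the parameters with value below \<open>u\<close>, would contradict
  monotonicity or the choice of \<open>t\<close>.\<close>

lemma arclen_surj:
  assumes f: "continuous_on {0..1} f" "finite_length f 0 1"
    and u: "0 \<le> u" "u \<le> arclen f 1"
  shows "\<exists>x\<in>{0..1}. arclen f x = u"
proof (rule ccontr)
  assume no: "\<not> ?thesis"
  note mono = arclen_mono[OF f(2)]
  define X where "X = {x \<in> {0..1}. arclen f x < u}"
  have "arclen f 0 \<noteq> u" using no by (metis atLeastAtMost_iff order_refl zero_le_one)
  then have "0 < u" using u(1) by simp
  then have "0 \<in> X" by (simp add: X_def)
  have bdd: "bdd_above X" by (rule bdd_aboveI[of _ 1]) (auto simp: X_def)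
  define t where "t = Sup X"
  have t_ge: "x \<le> t" if "x \<in> X" for x
    unfolding t_def by (rule cSup_upper[OF that bdd])
  have "t \<le> 1"
    unfolding t_def using \<open>0 \<in> X\<close> by (intro cSup_least) (blast, simp add: X_def)
  then have t: "t \<in> {0..1}" using t_ge[OF \<open>0 \<in> X\<close>] by simp
  consider "arclen f t < u" | "u < arclen f t"
    using no t by (meson linorder_neqE_linordered_idom)
  then show False
  proof cases
    case 1
    have "0 \<le> arclen f t" using mono[of 0 t] t by simp
    then obtain z where z: "z \<in> {0..1}" "arclen f t < arclen f z" "arclen f z < u"
      using arclen_no_gap[OF f _ 1 u(2)] by blast
    then have "z \<le> t" using t_ge[of z] by (simp add: X_def)
    then show False using mono[of z t] z t by simp
  next
    case 2
    have "arclen f t \<le> arclen f 1" using mono[of t 1] t by simp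
    then obtain z where z: "z \<in> {0..1}" "u < arclen f z" "arclen f z < arclen f t"
      using arclen_no_gap[OF f u(1) 2] by blast
    then have "z < t" using mono[of t z] t by force
    then obtain w where "w \<in> X" "z < w"
      using less_cSupD[of X z] \<open>0 \<in> X\<close> unfolding t_def by blast
    then show False using mono[of z w] z by (auto simp: X_def)
  qed
qed

section \<open>Reparametrization by arc length\<close>

text \<open>\<open>the_inv_into\<close> is meaningful only on the image of the arc length, which by
  \<open>arclen_surj\<close> is the whole interval. There the composition is 1-Lipschitz, because
  chords are bounded by differences of arc length.\<close>

lemma arclen_inverse_param:
  assumes f: "f \<in> open_params"
  shows "continuous_on {0..length_on f 0 1} (f \<circ> the_inv_into {0..1} (arclen f))"
    and "(f \<circ> the_inv_into {0..1} (arclen f)) ` {0..length_on f 0 1} \<subseteq> f ` {0..1}"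
    and "(f \<circ> the_inv_into {0..1} (arclen f)) 0 = f 0"
    and "(f \<circ> the_inv_into {0..1} (arclen f)) (length_on f 0 1) = f 1"
proof -
  let ?s = "arclen f" and ?h = "the_inv_into {0..1} (arclen f)"
  have L: "length_on f 0 1 = ?s 1" by (simp add: arclen_def)
  have c: "continuous_on {0..1} f" and fin: "finite_length f 0 1"
    and sm: "strict_mono_on {0..1} ?s"
    using f by (auto simp: open_params_def)
  have inj: "inj_on ?s {0..1}" using sm by (rule strict_mono_on_imp_inj_on)
  have inv: "?h (?s x) = x" if "x \<in> {0..1}" for x
    using inj that by (rule the_inv_into_f_f)
  have ex: "\<exists>x\<in>{0..1}. u = ?s x \<and> ?h u = x" if "u \<in> {0..?s 1}" for u
    using arclen_surj[OF c fin, of u] that inv by auto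
  show "(f \<circ> ?h) ` {0..length_on f 0 1} \<subseteq> f ` {0..1}"
    unfolding L using ex by fastforce
  show "(f \<circ> ?h) 0 = f 0" using inv[of 0] by simp
  show "(f \<circ> ?h) (length_on f 0 1) = f 1" unfolding L using inv[of 1] by simp
  have chord: "norm (f x - f y) \<le> \<bar>?s x - ?s y\<bar>" if "x \<in> {0..1}" "y \<in> {0..1}" for x y
    using chord_le_arclen[OF fin, of x y] chord_le_arclen[OF fin, of y x] that
    by (cases "x \<le> y") (auto simp: norm_minus_commute)
  have "dist ((f \<circ> ?h) u) ((f \<circ> ?h) w) \<le> 1 * dist u w" if "u \<in> {0..?s 1}" "w \<in> {0..?s 1}" for u w
    using ex[OF that(1)] ex[OF that(2)] chord[of "?h u" "?h w"] by (auto simp: dist_norm)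
  then have "1-lipschitz_on {0..?s 1} (f \<circ> ?h)"
    by (intro lipschitz_onI) auto
  then show "continuous_on {0..length_on f 0 1} (f \<circ> ?h)"
    unfolding L by (rule lipschitz_on_continuous_on)
qed

subsection \<open>Constant-speed parametrizations\<close>

text \<open>Equivalence classes are nonempty, so the \<open>SOME\<close> in \<open>curve_rep\<close>
  picks a genuine parametrization.\<close>

lemma curve_rep_open_params:
  assumes "C \<in> curve_space"
  shows "curve_rep C \<in> open_params"
    and "C = Inr X \<Longrightarrow> curve_rep C 0 = curve_rep C 1"
proof -
  have some: "(SOME f. f \<in> X) \<in> P" if "equiv P R" "X \<in> P // R"
    for X P and R :: "((real \<Rightarrow> plane) \<times> _) set"
    using in_quotient_imp_non_empty[OF that] in_quotient_imp_subset[OF that]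
    by (metis some_in_eq subsetD)
  have *: "curve_rep C \<in> (case C of Inl _ \<Rightarrow> open_params | Inr _ \<Rightarrow> closed_params)"
    using assms some[OF equiv_open_rel] some[OF equiv_closed_rel]
    by (auto simp: curve_space_def curve_rep_def)
  then show "curve_rep C \<in> open_params"
    by (auto simp: closed_params_def split: sum.splits)
  show "curve_rep C 0 = curve_rep C 1" if "C = Inr X"
    using * that by (auto simp: closed_params_def)
qed

lemma const_speed_props:
  assumes "C \<in> curve_space" "curve_length C > 0"
  shows "continuous_on {0..1} (const_speed C)"
    and "const_speed C ` {0..1} \<subseteq> curve_trace C"
    and "C = Inr X \<Longrightarrow> const_speed C 0 = const_speed C 1"
proof -
  note f = arclen_inverse_param[OF curve_rep_open_params(1)[OF assms(1)],
      folded arc_rep_def curve_length_def curve_trace_def]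
  have sub: "(\<lambda>t. curve_length C * t) ` {0..1} \<subseteq> {0..curve_length C}"
    using assms(2) by (auto simp: mult_le_cancel_left1)
  have eq: "const_speed C = arc_rep C \<circ> (\<lambda>t. curve_length C * t)"
    by (auto simp: const_speed_def)
  show "continuous_on {0..1} (const_speed C)"
    unfolding eq by (intro continuous_on_compose continuous_intros continuous_on_subset[OF f(1) sub])
  show "const_speed C ` {0..1} \<subseteq> curve_trace C"
    unfolding eq image_comp[symmetric] using f(2) sub by blast
  show "const_speed C 0 = const_speed C 1" if "C = Inr X"
    using f(3,4) curve_rep_open_params(2)[OF assms(1) that] by (simp add: const_speed_def)
qed

text \<open>The jump of \<open>frac\<close> at integers is absorbed by \<open>g 0 = g 1\<close>. The
  range \<open>{-1..2}\<close> contains every \<open>t + \<theta>\<close> and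
  \<open>\<theta> - t\<close> with \<open>t\<close> in \<open>{0..1}\<close> and
  \<open>\<theta>\<close> in \<open>{0..<1}\<close>, the arguments occurring in
  \<open>fw_params\<close>.\<close>

lemma continuous_on_frac_compose:
  fixes g :: "real \<Rightarrow> 'a::topological_space"
  assumes g: "continuous_on {0..1} g" "g 0 = g 1"
  shows "continuous_on {-1..2} (\<lambda>x. g (frac x))"
proof -
  have piece: "continuous_on {of_int n..of_int n + 1} (\<lambda>x. g (frac x))" for n :: int
  proof (rule continuous_on_eq)
    show "continuous_on {of_int n..of_int n + 1} (\<lambda>x. g (x - of_int n))"
      by (rule continuous_on_compose2[OF g(1)]) (auto intro!: continuous_intros)
    fix x :: real assume x: "x \<in> {of_int n..of_int n + 1}"
    show "g (x - of_int n) = g (frac x)"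
    proof (cases "x = of_int n + 1")
      case True
      then have "frac x = 0" by (metis Ints_of_int frac_eq_0_iff of_int_1 of_int_add)
      then show ?thesis using True g(2) by simp
    next
      case False
      then have "frac x = x - of_int n" using x by (auto simp: frac_unique_iff)
      then show ?thesis by simp
    qed
  qed
  have "{-1..2::real} = {-1..0} \<union> ({0..1} \<union> {1..2})" by auto
  then show ?thesis
    using piece[of "-1"] piece[of 0] piece[of 1]
    by (auto intro!: continuous_on_closed_Un)
qed

lemma fw_params_props:
  assumes C: "C \<in> curve_space" "curve_length C > 0" and \<alpha>: "\<alpha> \<in> fw_params C"
  shows "continuous_on {0..1} \<alpha>" and "\<alpha> ` {0..1} \<subseteq> curve_trace C"
proof -
  note cs = const_speed_props[OF C]
  have in_trace: "const_speed C t \<in> curve_trace C" if "0 \<le> t" "t \<le> 1" for t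
    using cs(2) that by auto
  have "continuous_on {0..1} \<alpha> \<and> \<alpha> ` {0..1} \<subseteq> curve_trace C"
  proof (cases C)
    case (Inl X)
    have "continuous_on {0..1} (\<lambda>t. const_speed C (1 - t))"
      by (rule continuous_on_compose2[OF cs(1)]) (auto intro!: continuous_intros)
    then show ?thesis using \<alpha> Inl cs(1) in_trace by (auto simp: fw_params_def)
  next
    case (Inr X)
    note fr = continuous_on_frac_compose[OF cs(1) cs(3)[OF Inr]]
    have "continuous_on {0..1} (\<lambda>t. const_speed C (frac (t + \<theta>)))"
      "continuous_on {0..1} (\<lambda>t. const_speed C (frac (\<theta> - t)))" if "0 \<le> \<theta>" "\<theta> < 1" for \<theta>
      using that by (auto intro!: continuous_on_compose2[OF fr] continuous_intros)
    moreover have "const_speed C (frac x) \<in> curve_trace C" for x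
      using in_trace frac_ge_0[of x] frac_lt_1[of x] by simp
    ultimately show ?thesis using \<alpha> Inr by (auto simp: fw_params_def)
  qed
  then show "continuous_on {0..1} \<alpha>" "\<alpha> ` {0..1} \<subseteq> curve_trace C" by auto
qed

subsection \<open>The loop as the boundary of a square\<close>

definition line_homotopy :: "(real \<Rightarrow> plane) \<Rightarrow> (real \<Rightarrow> plane) \<Rightarrow> real \<times> real \<Rightarrow> plane" where
  "line_homotopy \<alpha> \<beta> = (\<lambda>(s, t). (1 - s) *\<^sub>R \<alpha> t + s *\<^sub>R \<beta> t)"

text \<open>With coordinates \<open>(s, t)\<close>, the four sides are traversed so that the line
  homotopy yields in turn \<alpha>, the segment at \<open>t = 1\<close>, \<beta> reversed and the
  segment at \<open>t = 0\<close>. The joins are bracketed as in \<open>fw_loop\<close>, so the two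
  loops agree as functions.\<close>

definition square_boundary :: "real \<Rightarrow> real \<times> real" where
  "square_boundary = (linepath (0, 0) (0, 1) +++ linepath (0, 1) (1, 1)) +++
     (linepath (1, 1) (1, 0) +++ linepath (1, 0) (0, 0))"

lemma fw_loop_eq: "fw_loop \<alpha> \<beta> = line_homotopy \<alpha> \<beta> \<circ> square_boundary"
  unfolding fw_loop_def square_boundary_def path_compose_join
  by (intro arg_cong2[where f = joinpaths])
     (auto simp: line_homotopy_def linepath_def reversepath_def algebra_simps)

lemma path_square_boundary: "path square_boundary"
  unfolding square_boundary_def by (auto intro!: path_join_imp)

lemma square_boundary_closed: "square_boundary 0 = square_boundary 1"
  by (simp add: square_boundary_def joinpaths_def linepath_def)

lemma square_boundary_in_square: "square_boundary ` {0..1} \<subseteq> {0..1} \<times> {0..1}"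
proof -
  have "closed_segment a b \<subseteq> {0..1} \<times> {0..1}"
    if "a \<in> {0..1} \<times> {0..1}" "b \<in> {0..1} \<times> {0..1}" for a b :: "real \<times> real"
    by (rule closed_segment_subset[OF that]) (intro convex_Times convex_real_interval)
  then show ?thesis
    unfolding square_boundary_def path_image_def[symmetric]
    by (auto simp: path_image_join)
qed

lemma continuous_on_line_homotopy:
  assumes "continuous_on {0..1} \<alpha>" "continuous_on {0..1} \<beta>"
  shows "continuous_on ({0..1} \<times> {0..1}) (line_homotopy \<alpha> \<beta>)"
  unfolding line_homotopy_def case_prod_beta
  by (intro continuous_intros continuous_on_compose2[OF assms(1)] continuous_on_compose2[OF assms(2)])
     auto

text \<open>The direction map from \<open>p\<close> extends from the boundary to the whole square,
  where it has a continuous logarithm. A single-valued logarithm returns to its starting value along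
  the closed boundary, so the total change of angle is 0.\<close>

lemma mod2_degree_eq_0:
  assumes F: "continuous_on ({0..1} \<times> {0..1}) F" "p \<notin> F ` ({0..1} \<times> {0..1})"
  shows "mod2_degree (F \<circ> square_boundary) p = 0"
proof -
  let ?Q = "{0..1} \<times> {0..1} :: (real \<times> real) set"
  define G where "G = (\<lambda>z. (F z - p) /\<^sub>R norm (F z - p))"
  define H where "H = (\<lambda>z. Complex (G z $ 1) (G z $ 2))"
  define u where "u = (\<lambda>t. G (square_boundary t))"
  have ne: "F z - p \<noteq> 0" if "z \<in> ?Q" for z using F(2) that by auto
  have G: "continuous_on ?Q G"
    unfolding G_def using ne by (intro continuous_intros F(1)) auto
  have nG: "norm (G z) = 1" if "z \<in> ?Q" for z
    using ne[OF that] by (simp add: G_def)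
  have H: "continuous_on ?Q H"
    unfolding H_def Complex_eq by (intro continuous_intros G)
  have nH: "H z \<noteq> 0" if "z \<in> ?Q" for z
    using nG[OF that] by (auto simp: H_def complex_eq_iff norm_vec_def L2_set_def sum_2)
  have contr: "contractible ?Q"
    by (intro convex_imp_contractible convex_Times convex_real_interval)
  obtain g where g: "continuous_on ?Q g" "\<And>z. z \<in> ?Q \<Longrightarrow> H z = exp (g z)"
    using continuous_logarithm_on_contractible[OF H contr nH] by blast
  have sq: "square_boundary t \<in> ?Q" if "t \<in> {0..1}" for t
    using square_boundary_in_square that by blast
  have cb: "continuous_on {0..1} square_boundary"
    using path_square_boundary by (simp add: path_def)
  have "of_int (circle_degree u) = winding_number (\<lambda>t. Complex (u t $ 1) (u t $ 2)) 0"
  proof (rule circle_degree_winding_number)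
    show "continuous_on {0..1} u"
      unfolding u_def by (rule continuous_on_compose2[OF G cb square_boundary_in_square])
    show "u 0 = u 1" by (simp add: u_def square_boundary_closed)
    show "norm (u t) = 1" if "t \<in> {0..1}" for t
      using nG sq that by (simp add: u_def)
  qed
  also have "\<dots> = winding_number (exp \<circ> (g \<circ> square_boundary)) 0"
    using g(2) sq by (intro winding_number_cong) (simp add: u_def H_def)
  also have "\<dots> = 0"
  proof -
    have "path (g \<circ> square_boundary)"
      unfolding path_def
      by (intro continuous_on_compose cb continuous_on_subset[OF g(1) square_boundary_in_square])
    \<comment> \<open>The winding number of \<open>exp \<circ> q\<close> about 0 is
      \<open>(q 1 - q 0) / (2 * pi * \<i>)\<close>, and here the endpoints of \<open>q\<close>
      coincide.\<close>
    from winding_number_compose_exp[OF this] show ?thesis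
      by (simp add: pathfinish_def pathstart_def square_boundary_closed)
  qed
  finally have "circle_degree u = 0" by simp
  then show ?thesis by (simp add: mod2_degree_def u_def G_def)
qed

subsection \<open>Containment in the global band\<close>

text \<open>The band is the continuous image of the compact product of \<open>{0..1}\<close> and the
  two traces. Closedness lets containment pass to the closure in \<open>fw_band\<close>.\<close>

lemma closed_global_band:
  assumes "A \<in> curve_space" "B \<in> curve_space"
  shows "closed (global_band A B)"
proof -
  have trace: "compact (curve_trace C)" if "C \<in> curve_space" for C
    using curve_rep_open_params(1)[OF that] unfolding curve_trace_def open_params_def
    by (auto intro: compact_continuous_image)
  let ?T = "{0..1::real} \<times> (curve_trace A \<times> curve_trace B)"
  let ?m = "\<lambda>z::real \<times> plane \<times> plane. (1 - fst z) *\<^sub>R fst (snd z) + fst z *\<^sub>R snd (snd z)"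
  have "global_band A B = ?m ` ?T"
    unfolding global_band_def by force
  moreover have "compact (?m ` ?T)"
    using trace assms by (intro compact_continuous_image continuous_intros compact_Times) auto
  ultimately show ?thesis by (simp add: compact_imp_closed)
qed

lemma line_homotopy_in_global_band:
  assumes "\<alpha> ` {0..1} \<subseteq> curve_trace A" "\<beta> ` {0..1} \<subseteq> curve_trace B"
  shows "line_homotopy \<alpha> \<beta> ` ({0..1} \<times> {0..1}) \<subseteq> global_band A B"
  using assms unfolding line_homotopy_def global_band_def by fastforce

lemma fw_region_subset_global_band:
  assumes "continuous_on {0..1} \<alpha>" "\<alpha> ` {0..1} \<subseteq> curve_trace A"
    and "continuous_on {0..1} \<beta>" "\<beta> ` {0..1} \<subseteq> curve_trace B"
  shows "fw_region \<alpha> \<beta> \<subseteq> global_band A B"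
proof -
  note band = line_homotopy_in_global_band[OF assms(2,4)]
  have "path_image (fw_loop \<alpha> \<beta>) \<subseteq> global_band A B"
    unfolding fw_loop_eq path_image_def image_comp[symmetric]
    using band square_boundary_in_square by blast
  \<comment> \<open>A point outside the band is missed by the homotopy on the whole square, so its
    parity cannot be 1.\<close>
  moreover have "mod2_degree (fw_loop \<alpha> \<beta>) p = 0" if "p \<notin> global_band A B" for p
    unfolding fw_loop_eq using band that
    by (intro mod2_degree_eq_0 continuous_on_line_homotopy assms) blast
  ultimately show ?thesis unfolding fw_region_def by force
qed

theorem proposition4p7:
  fixes A B :: curve
  assumes "A \<in> curve_space" and "B \<in> curve_space"
    and "curve_length A > 0" and "curve_length B > 0"
  shows "fw_band A B \<subseteq> global_band A B"
  unfolding fw_band_def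
proof (rule closure_minimal)
  show "closed (global_band A B)" using assms(1,2) by (rule closed_global_band)
  have "fw_region \<alpha> \<beta> \<subseteq> global_band A B" if "(\<alpha>, \<beta>) \<in> fw_minimizers A B" for \<alpha> \<beta>
  proof -
    have "\<alpha> \<in> fw_params A" "\<beta> \<in> fw_params B"
      using that by (auto simp: fw_minimizers_def is_arg_min_def)
    then show ?thesis
      using assms by (intro fw_region_subset_global_band fw_params_props)
  qed
  then show "(\<Union>(\<alpha>, \<beta>)\<in>fw_minimizers A B. fw_region \<alpha> \<beta>) \<subseteq> global_band A B" by blast
qed

end
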